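(* For every graph $G$ we have $\mathsf{tree}\text{-}\alpha(G)\le\alpha(G)$.
   Context: All graphs are finite, simple, and undirected; $\alpha(G)$ denotes the maximum size of an independent set in $G$. A tree decomposition of a graph $G$ is a pair $\mathcal{T}=(T,\{X_t\}_{t\in V(T)})$ where $T$ is a tree and each node $t$ is assigned a bag $X_t\subseteq V(G)$ such that every vertex of $G$ is in at least one bag, every edge of $G$ has both endpoints in some common bag, and for every $u\in V(G)$ the subgraph of $T$ induced by $\{t: u\in X_t\}$ is connected. The independence number of $\mathcal{T}$ is $\alpha(\mathcal{T})=\max_{t\in V(T)}\alpha(G[X_t])$. The tree-independence number $\mathsf{tree}\text{-}\alpha(G)$ is the minimum of $\alpha(\mathcal{T})$ over all tree decompositions $\mathcal{T}$ of $G$. *)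

theory Defs
  imports "Graph_Theory.Digraph_Component"
begin

text \<open>
  Finite simple undirected graphs are the locale \<^locale>\<open>graph\<close>: every undirected
  edge \<open>uv\<close> is a pair of opposite arcs \<open>u \<rightarrow> v\<close> and \<open>v \<rightarrow> u\<close>. The null graph is included.
\<close>

definition independent_set :: "('a, 'b) pre_digraph \<Rightarrow> 'a set \<Rightarrow> bool" where
  "independent_set G S \<longleftrightarrow> S \<subseteq> verts G \<and> (\<forall>u\<in>S. \<forall>v\<in>S. \<not> u \<rightarrow>\<^bsub>G\<^esub> v)"

definition independence_number :: "('a, 'b) pre_digraph \<Rightarrow> nat" where
  "independence_number G = Max (card ` {S. independent_set G S})"

text \<open>
  The library constant \<^const>\<open>tree\<close> forbids directed cycles, and so also the closed walk
  \<open>u, v, u\<close> along a single undirected edge. A cycle of a simple undirected graph is a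
  directed cycle of length at least three in its symmetric representation.
  As usual, trees are nonempty; this is part of \<^const>\<open>connected\<close>.
\<close>

definition undirected_tree :: "('a, 'b) pre_digraph \<Rightarrow> bool" where
  "undirected_tree T \<longleftrightarrow>
     graph T \<and> connected T \<and> \<not> (\<exists>p. pre_digraph.cycle T p \<and> 3 \<le> length p)"

definition tree_decomposition ::
    "('a, 'b) pre_digraph \<Rightarrow> ('t, 'c) pre_digraph \<Rightarrow> ('t \<Rightarrow> 'a set) \<Rightarrow> bool" where
  "tree_decomposition G T X \<longleftrightarrow>
     undirected_tree T \<and>
     (\<forall>t\<in>verts T. X t \<subseteq> verts G) \<and>
     (\<forall>u\<in>verts G. \<exists>t\<in>verts T. u \<in> X t) \<and>
     (\<forall>u v. u \<rightarrow>\<^bsub>G\<^esub> v \<longrightarrow> (\<exists>t\<in>verts T. u \<in> X t \<and> v \<in> X t)) \<and>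
     (\<forall>u\<in>verts G. connected (T \<restriction> {t \<in> verts T. u \<in> X t}))"

definition decomposition_independence_number ::
    "('a, 'b) pre_digraph \<Rightarrow> ('t, 'c) pre_digraph \<Rightarrow> ('t \<Rightarrow> 'a set) \<Rightarrow> nat" where
  "decomposition_independence_number G T X =
     Max ((\<lambda>t. independence_number (G \<restriction> X t)) ` verts T)"

text \<open>
  A definition cannot quantify over the type of the nodes of the tree. Taking natural
  numbers as nodes and pairs of them as arcs is no restriction: every finite tree is
  isomorphic to one of this form.
\<close>

definition tree_independence_number :: "('a, 'b) pre_digraph \<Rightarrow> nat" where
  "tree_independence_number G =
     (LEAST k. \<exists>(T :: (nat, nat \<times> nat) pre_digraph) X.
        tree_decomposition G T X \<and> k = decomposition_independence_number G T X)"

end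

theory Submission
  imports Defs
begin

text \<open>The trivial tree decomposition, one node whose bag is the whole vertex set, has
  independence number exactly \<open>independence_number G\<close>, so the minimum over all
  decompositions cannot exceed it. \<open>undirected_tree_single_vertex\<close> supplies the tree;
  \<open>induce_subgraph_verts_self\<close> serves both for the bag in \<open>G\<close> and for the
  connectivity condition in \<open>T\<close>.\<close>

lemma (in wf_digraph) induce_subgraph_verts_self: "G \<restriction> verts G = G"
  by (intro pre_digraph.equality) auto

text \<open>Without arcs every walk is empty, whereas a cycle is nonempty; \<open>f\<close> and
  \<open>g\<close> may be arbitrary.\<close>

lemma undirected_tree_single_vertex:
  "undirected_tree \<lparr>verts = {t}, arcs = {}, tail = f, head = g\<rparr>"
proof -
  let ?T = "\<lparr>verts = {t}, arcs = {}, tail = f, head = g\<rparr>"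
  interpret T: graph ?T
    by unfold_locales (auto simp: symmetric_def arcs_ends_def)
  have "connected ?T"
    by (auto simp: connected_def strongly_connected_def mk_symmetric_def reachable_def
      intro: rtrancl_on_refl)
  moreover have "\<not> T.cycle p" for p
    by (auto simp: T.cycle_def T.awalk_def)
  ultimately show ?thesis
    using T.graph_axioms by (auto simp: undirected_tree_def)
qed

theorem mainTheorem14:
  fixes G :: "('a, 'b) pre_digraph"
  assumes "graph G"
  shows "tree_independence_number G \<le> independence_number G"
proof -
  interpret graph G by fact
  define T :: "(nat, nat \<times> nat) pre_digraph"
    where "T = \<lparr>verts = {0}, arcs = {}, tail = fst, head = snd\<rparr>"
  define X where "X = (\<lambda>t :: nat. verts G)"
  have T: "undirected_tree T"
    unfolding T_def by (rule undirected_tree_single_vertex)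
  then interpret T: graph T by (simp add: undirected_tree_def)
  have "T \<restriction> {t \<in> verts T. u \<in> X t} = T" if "u \<in> verts G" for u
    using that T.induce_subgraph_verts_self by (simp add: X_def)
  \<comment> \<open>As the bags are constant, covering vertices and edges only takes the existence
    of a node.\<close>
  moreover have "verts T \<noteq> {}"
    by (simp add: T_def)
  ultimately have "tree_decomposition G T X"
    using T by (auto simp: tree_decomposition_def undirected_tree_def X_def)
  moreover have "independence_number G = decomposition_independence_number G T X"
    by (simp add: decomposition_independence_number_def X_def T_def induce_subgraph_verts_self)
  ultimately show ?thesis
    unfolding tree_independence_number_def by (intro Least_le) blast
qed

end
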